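(* Let $n\ge 1$, let $\mathbf{x}=(x_0,x_1,\dots,x_n)\in\mathcal{X}^{n+1}$ be any sequence of contexts, and let $\pi$ be any separable policy. Then $$\sup_{F_0\in\Delta(\mathcal{Y})}\ \sup_{\substack{F_1,\dots,F_n\in\Delta(\mathcal{Y})\\ \|F_0-F_i\|_W\le d(x_0,x_i)\ \forall i}}\mathbb{E}_{\mathbf{y}\sim F_1\times\cdots\times F_n}\big[R(\pi(\mathbf{x},\mathbf{y}),F_0)\big]$$ $$\le\ \inf_{\boldsymbol{\lambda}\in\mathbb{R}_+^n}\ \sup_{\mu_0,\dots,\mu_n\in[0,1]}\Big\{\mathbb{E}_{\mathbf{y}\sim\mathcal{B}(\mu_1)\times\cdots\times\mathcal{B}(\mu_n)}\big[R(\pi(\mathbf{x},\mathbf{y}),\mathcal{B}(\mu_0))\big]+\sum_{i=1}^n\lambda_i\big(d(x_0,x_i)-|\mu_0-\mu_i|\big)\Big\}.$$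
   Context: Let $\mathcal{Y}=[0,1]$ and let $\Delta(\mathcal{Y})$ be the set of probability distributions on $\mathcal{Y}$; an element $F\in\Delta(\mathcal{Y})$ is identified with its cumulative distribution function (cdf). Let $\mathcal{X}$ be a set (of contexts) and $d:\mathcal{X}\times\mathcal{X}\to\mathbb{R}$ a non-negative function (the dissimilarity). Costs $c_o,c_u>0$ satisfy $c_o+c_u=1$, and $q=c_u/(c_u+c_o)$. Wasserstein distance: for $F,H\in\Delta(\mathcal{Y})$, $\|F-H\|_W=\int_0^1|F(y)-H(y)|\,dy$. Newsvendor loss: $\ell(a,y)=c_o(a-y)^+ + c_u(y-a)^+$ for $a,y\in\mathcal{Y}$, where $z^+=\max(0,z)$. For $a\in\mathcal{Y}$, $F_0\in\Delta(\mathcal{Y})$: $L(a,F_0)=\mathbb{E}_{y\sim F_0}[\ell(a,y)]$, $a^*_{F_0}=\inf\{a\in\mathcal{Y}: F_0(a)\ge q\}$, $R(a,F_0)=L(a,F_0)-L(a^*_{F_0},F_0)$. For $\nu\in\Delta(\mathcal{Y})$: $L(\nu,F_0)=\mathbb{E}_{a\sim\nu}[L(a,F_0)]$ and $R(\nu,F_0)=L(\nu,F_0)-L(a^*_{F_0},F_0)$. A data-driven policy (possibly randomized) is a map $\pi:\mathcal{X}^{n+1}\times\mathcal{Y}^n\to\Delta(\mathcal{Y})$, measurable in $\mathbf{y}$ so that all expectations make sense. The contexts $\mathbf{x}$ are fixed. Separable policy: $\pi$ is separable if there is a function $P^\pi:[0,1]^n\to[0,1]$ (possibly depending on the fixed $\mathbf{x}$)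 such that for all $F_1,\dots,F_n\in\Delta(\mathcal{Y})$ and all $y\in\mathbb{R}$, $$\mathbb{P}_{\mathbf{y}\sim F_1\times\cdots\times F_n,\ a\sim\pi(\mathbf{x},\mathbf{y})}(a\le y)=P^\pi(F_1(y),\dots,F_n(y)).$$ $\mathcal{B}(\mu)$ denotes the Bernoulli distribution on $\{0,1\}$ with mean $\mu\in[0,1]$. *)

theory Defs
  imports "HOL-Probability.Probability"
begin

text \<open>
  The outcome space \<open>[0,1]\<close> carries the trace of the Borel sigma-algebra, so that elements of
  \<open>\<Delta>\<close> are measures living on \<open>[0,1]\<close> itself. The library cdf,
  \<open>measure F {..y}\<close>, would be \<open>0\<close> for such an \<open>F\<close>, since \<open>{..y}\<close> is not a subset of \<open>[0,1]\<close>;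
  the cdf is the measure of \<open>{a \<in> [0,1]. a \<le> y}\<close>.
\<close>

definition Y_space :: "real measure" where
  "Y_space = restrict_space borel {0..1}"

definition Delta :: "real measure set" where
  "Delta = space (prob_algebra Y_space)"

definition cdfY :: "real measure \<Rightarrow> real \<Rightarrow> real" where
  "cdfY F y = \<P>(a in F. a \<le> y)"

definition wasserstein :: "real measure \<Rightarrow> real measure \<Rightarrow> real" where
  "wasserstein F H = (LBINT y:{0..1}. \<bar>cdfY F y - cdfY H y\<bar>)"

definition bern :: "real \<Rightarrow> real measure" where
  "bern \<mu> = distr (measure_pmf (bernoulli_pmf \<mu>)) Y_space of_bool"

definition loss :: "real \<Rightarrow> real \<Rightarrow> real \<Rightarrow> real \<Rightarrow> real" where
  "loss c\<^sub>o c\<^sub>u a y = c\<^sub>o * max 0 (a - y) + c\<^sub>u * max 0 (y - a)"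

definition cost :: "real \<Rightarrow> real \<Rightarrow> real \<Rightarrow> real measure \<Rightarrow> real" where
  "cost c\<^sub>o c\<^sub>u a F0 = (LINT y|F0. loss c\<^sub>o c\<^sub>u a y)"

definition opt_action :: "real \<Rightarrow> real \<Rightarrow> real measure \<Rightarrow> real" where
  "opt_action c\<^sub>o c\<^sub>u F0 = Inf {a \<in> {0..1}. cdfY F0 a \<ge> c\<^sub>u / (c\<^sub>u + c\<^sub>o)}"

definition mixed_cost :: "real \<Rightarrow> real \<Rightarrow> real measure \<Rightarrow> real measure \<Rightarrow> real" where
  "mixed_cost c\<^sub>o c\<^sub>u \<nu> F0 = (LINT a|\<nu>. cost c\<^sub>o c\<^sub>u a F0)"

definition regret :: "real \<Rightarrow> real \<Rightarrow> real measure \<Rightarrow> real measure \<Rightarrow> real" where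
  "regret c\<^sub>o c\<^sub>u \<nu> F0 = mixed_cost c\<^sub>o c\<^sub>u \<nu> F0 - cost c\<^sub>o c\<^sub>u (opt_action c\<^sub>o c\<^sub>u F0) F0"

text \<open>
  Contexts are indexed by \<open>{0..n}\<close> and samples by \<open>{1..n}\<close>; tuples are extensional functions.
  For each context tuple, a policy is a Markov kernel from \<open>[0,1]\<^sup>n\<close> to \<open>[0,1]\<close>.
\<close>

definition policies ::
  "'x set \<Rightarrow> nat \<Rightarrow> ((nat \<Rightarrow> 'x) \<Rightarrow> (nat \<Rightarrow> real) \<Rightarrow> real measure) set" where
  "policies X n = {\<pi>. \<forall>x \<in> {0..n} \<rightarrow>\<^sub>E X.
     \<pi> x \<in> (\<Pi>\<^sub>M i\<in>{1..n}. Y_space) \<rightarrow>\<^sub>M prob_algebra Y_space}"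

text \<open>
  The Giry bind below is the law of \<open>a\<close> when \<open>\<^bold>y\<close> is drawn from the product of the \<open>F i\<close>
  and then \<open>a\<close> from \<open>\<pi> x \<^bold>y\<close>.
\<close>

definition separable ::
  "nat \<Rightarrow> ((nat \<Rightarrow> 'x) \<Rightarrow> (nat \<Rightarrow> real) \<Rightarrow> real measure) \<Rightarrow> (nat \<Rightarrow> 'x) \<Rightarrow> bool" where
  "separable n \<pi> x \<longleftrightarrow>
     (\<exists>P \<in> ({1..n} \<rightarrow>\<^sub>E {0..1::real}) \<rightarrow> {0..1::real}.
        \<forall>F \<in> {1..n} \<rightarrow>\<^sub>E Delta. \<forall>y::real.
          \<P>(a in ((\<Pi>\<^sub>M i\<in>{1..n}. F i) \<bind> \<pi> x). a \<le> y) = P (\<lambda>i\<in>{1..n}. cdfY (F i) y))"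

definition expected_regret ::
  "real \<Rightarrow> real \<Rightarrow> nat \<Rightarrow> ((nat \<Rightarrow> 'x) \<Rightarrow> (nat \<Rightarrow> real) \<Rightarrow> real measure) \<Rightarrow> (nat \<Rightarrow> 'x) \<Rightarrow>
     real measure \<Rightarrow> (nat \<Rightarrow> real measure) \<Rightarrow> real" where
  "expected_regret c\<^sub>o c\<^sub>u n \<pi> x F0 F =
     (LINT y|(\<Pi>\<^sub>M i\<in>{1..n}. F i). regret c\<^sub>o c\<^sub>u (\<pi> x y) F0)"

end

theory Submission
  imports Defs
begin

text \<open>
  By the layer-cake formula \<open>\<ell>(a, y) = \<integral>\<^sub>0\<^sup>1 c\<^sub>o [y \<le> t < a] + c\<^sub>u [a \<le> t < y] dt\<close>, the expected cost of
  an action with cdf \<open>G\<close> is \<open>\<integral>\<^sub>0\<^sup>1 c\<^sub>o F\<^sub>0(t) (1 - G(t)) + c\<^sub>u (1 - F\<^sub>0(t)) G(t) dt\<close>, while any single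
  action costs at least \<open>\<integral>\<^sub>0\<^sup>1 min (c\<^sub>u (1 - F\<^sub>0(t))) (c\<^sub>o F\<^sub>0(t)) dt\<close>. For a separable policy
  \<open>G(t)\<close> depends only on the numbers \<open>F\<^sub>i(t)\<close>, so the regret is at most the integral over \<open>t\<close> of
  the regret in the Bernoulli instance with means \<open>\<mu>\<^sub>i = 1 - F\<^sub>i(t)\<close>. The Wasserstein distance is an
  integral over \<open>t\<close> of \<open>\<bar>\<mu>\<^sub>0 - \<mu>\<^sub>i\<bar>\<close> as well, so the Lagrangian penalty can be added under the
  integral, and the integrand is bounded pointwise by the supremum over Bernoulli instances.
\<close>

section \<open>Lebesgue measure on the unit interval and the layer-cake formula\<close>

text \<open>Restricting the space, instead of writing set integrals, yields a probability measure:
  bounded measurable functions become integrable and constants integrate to themselves.\<close>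

definition unit_lborel :: "real measure" where
  "unit_lborel = restrict_space lborel {0..1}"

lemma space_unit_lborel [simp]: "space unit_lborel = {0..1}"
  by (simp add: unit_lborel_def space_restrict_space)

lemma measurable_unit_lborel:
  "f \<in> borel_measurable borel \<Longrightarrow> f \<in> borel_measurable unit_lborel"
  unfolding unit_lborel_def by (rule measurable_restrict_space1) simp

lemma emeasure_unit_lborel:
  assumes "A \<in> sets borel" "A \<subseteq> {0..1}"
  shows "emeasure unit_lborel A = emeasure lborel A"
  using assms unfolding unit_lborel_def by (intro emeasure_restrict_space) auto

interpretation unit_lborel: prob_space unit_lborel
  by standard (simp add: emeasure_unit_lborel)

lemma measure_unit_lborel [simp]: "measure unit_lborel {0..1} = 1"
  using unit_lborel.prob_space by simp

lemma integral_unit_lborel: "(LBINT t:{0..1}. f t) = (LINT t|unit_lborel. f t)" for f :: "real \<Rightarrow> real"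
  by (simp add: unit_lborel_def set_lebesgue_integral_def integral_restrict_space)

lemma unit_lborel_integrable:
  fixes f :: "real \<Rightarrow> real"
  assumes "f \<in> borel_measurable borel" "\<And>t. t \<in> {0..1} \<Longrightarrow> \<bar>f t\<bar> \<le> B"
  shows "integrable unit_lborel f"
  using assms
  by (intro unit_lborel.integrable_const_bound[of _ B] measurable_unit_lborel AE_I2) auto

lemma unit_lborel_integral_Ico:
  fixes a b :: real
  assumes "a \<in> {0..1}" "b \<in> {0..1}"
  shows "(LINT t|unit_lborel. indicator {a..<b} t) = max 0 (b - a)"
proof -
  have "emeasure unit_lborel {a..<b} = emeasure lborel {a..<b}"
    using assms by (intro emeasure_unit_lborel) auto
  then have "measure unit_lborel {a..<b} = max 0 (b - a)"
    by (cases "a \<le> b") (auto simp: measure_def)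
  moreover have "{a..<b} \<inter> {0..1} = {a..<b}"
    using assms by auto
  ultimately show ?thesis
    by simp
qed

text \<open>At \<open>t = 1\<close> every cdf jumps to 1, whatever the Bernoulli mean; this removes
  that point from the integrals.\<close>

lemma AE_unit_lborel_less_1: "AE t in unit_lborel. t < 1"
proof (rule AE_I')
  have "{1} \<in> sets unit_lborel"
    unfolding unit_lborel_def by (subst sets_restrict_space_iff) auto
  then show "{1} \<in> null_sets unit_lborel"
    by (auto simp: null_sets_def emeasure_unit_lborel)
qed auto

text \<open>The positive parts of \<open>a - y\<close> and \<open>y - a\<close> are the lengths of
  \<open>{y..<a}\<close> and \<open>{a..<y}\<close>. The integrand is sorted by
  \<open>y \<le> t\<close> so that, for fixed \<open>t\<close>, it is a two-valued function of
  \<open>y\<close>, as \<open>Fubini_threshold\<close> expects.\<close>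

lemma loss_eq_integral:
  assumes "a \<in> {0..1}" "y \<in> {0..1}"
  shows "loss c\<^sub>o c\<^sub>u a y =
    (LINT t|unit_lborel. (if y \<le> t then c\<^sub>o * indicator {..<a} t else c\<^sub>u * indicator {a..} t))"
proof -
  have "(LINT t|unit_lborel. (if y \<le> t then c\<^sub>o * indicator {..<a} t else c\<^sub>u * indicator {a..} t)) =
        (LINT t|unit_lborel. c\<^sub>o * indicator {y..<a} t + c\<^sub>u * indicator {a..<y} t)"
    by (rule Bochner_Integration.integral_cong) (auto simp: indicator_def)
  also have "\<dots> = c\<^sub>o * (LINT t|unit_lborel. indicator {y..<a} t) + c\<^sub>u * (LINT t|unit_lborel. indicator {a..<y} t)"
  proof -
    have "integrable unit_lborel (indicator {u..<v} :: real \<Rightarrow> real)" for u v :: real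
      by (rule unit_lborel_integrable[of _ 1]) (auto simp: indicator_def)
    then show ?thesis
      by (subst Bochner_Integration.integral_add) (auto simp del: integral_indicator)
  qed
  also have "\<dots> = loss c\<^sub>o c\<^sub>u a y"
    using assms by (simp only: unit_lborel_integral_Ico loss_def)
  finally show ?thesis ..
qed

section \<open>Distributions on the unit interval and their cdfs\<close>

lemma DeltaD:
  assumes "F \<in> Delta"
  shows "prob_space F" "sets F = sets Y_space" "space F = {0..1}"
proof -
  show "prob_space F" and *: "sets F = sets Y_space"
    using assms by (simp_all add: Delta_def space_prob_algebra)
  show "space F = {0..1}"
    using sets_eq_imp_space_eq[OF *] by (simp add: Y_space_def space_restrict_space)
qed

lemma borel_measurable_Delta:
  assumes "F \<in> Delta" "f \<in> borel_measurable borel"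
  shows "f \<in> borel_measurable F"
proof -
  have "f \<in> borel_measurable Y_space"
    unfolding Y_space_def using assms(2) by (rule measurable_restrict_space1)
  then show ?thesis
    unfolding measurable_cong_sets[OF DeltaD(2)[OF assms(1)] refl] .
qed

lemma sets_Delta_le: "F \<in> Delta \<Longrightarrow> {a \<in> space F. a \<le> y} \<in> sets F"
  using borel_measurable_Delta[of F "\<lambda>a. a"] by (intro borel_measurable_le) auto

lemma cdfY_bounds:
  assumes "F \<in> Delta"
  shows "0 \<le> cdfY F t" "cdfY F t \<le> 1"
  using prob_space.prob_le_1[OF DeltaD(1)[OF assms]] by (auto simp: cdfY_def)

lemma cdfY_1:
  assumes "F \<in> Delta"
  shows "cdfY F 1 = 1"
proof -
  have "a \<le> 1" if "a \<in> space F" for a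
    using that by (simp add: DeltaD(3)[OF assms])
  then have "{a \<in> space F. a \<le> 1} = space F"
    by blast
  then show ?thesis
    unfolding cdfY_def by (simp only: prob_space.prob_space[OF DeltaD(1)[OF assms]])
qed

lemma mono_cdfY:
  assumes "F \<in> Delta"
  shows "mono (cdfY F)"
proof -
  interpret prob_space F using DeltaD(1)[OF assms] .
  show ?thesis
    unfolding cdfY_def
    by (intro monoI finite_measure_mono sets_Delta_le[OF assms]) auto
qed

lemma borel_measurable_cdfY [measurable]: "F \<in> Delta \<Longrightarrow> cdfY F \<in> borel_measurable borel"
  by (intro borel_measurable_mono mono_cdfY)

section \<open>Costs as integrals over thresholds\<close>

lemma integral_threshold:
  fixes c d :: real
  assumes "F \<in> Delta"
  shows "(LINT y|F. (if y \<le> t then c else d)) = c * cdfY F t + d * (1 - cdfY F t)"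
proof -
  interpret prob_space F using DeltaD(1)[OF assms] .
  let ?A = "{a \<in> space F. a \<le> t}"
  have A: "?A \<in> sets F" by (rule sets_Delta_le[OF assms])
  have "(LINT y|F. (if y \<le> t then c else d)) = (LINT y|F. d + (c - d) * indicator ?A y)"
    by (rule Bochner_Integration.integral_cong) (auto simp: indicator_def)
  also have "\<dots> = d + (c - d) * measure F ?A"
  proof -
    have "integrable F (indicator ?A :: real \<Rightarrow> real)"
      using A by (intro integrable_real_indicator) (simp_all add: less_top[symmetric])
    moreover have "?A \<inter> space F = ?A"
      by auto
    ultimately show ?thesis
      by (simp add: prob_space)
  qed
  finally show ?thesis
    by (simp add: cdfY_def algebra_simps)
qed

text \<open>The integrand is bounded and jointly measurable on a product of two probability spaces,
  so the integrals may be swapped; the inner one is then \<open>integral_threshold\<close>. It is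
  applied once to the demand and once to the action.\<close>

lemma Fubini_threshold:
  fixes f g :: "real \<Rightarrow> real"
  assumes F: "F \<in> Delta" and [measurable]: "f \<in> borel_measurable borel" "g \<in> borel_measurable borel"
    and B: "\<And>t. \<bar>f t\<bar> \<le> B" "\<And>t. \<bar>g t\<bar> \<le> B"
  shows "(LINT y|F. LINT t|unit_lborel. (if y \<le> t then f t else g t)) =
         (LINT t|unit_lborel. f t * cdfY F t + g t * (1 - cdfY F t))"
proof -
  interpret F: prob_space F using DeltaD(1)[OF F] .
  interpret P: pair_prob_space F unit_lborel ..
  have [measurable]: "(\<lambda>y. y) \<in> borel_measurable F" "(\<lambda>t. t) \<in> borel_measurable unit_lborel"
    "f \<in> borel_measurable unit_lborel" "g \<in> borel_measurable unit_lborel"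
    using F by (auto intro: borel_measurable_Delta measurable_unit_lborel)
  \<comment> \<open>The factors carry trace sigma-algebras, so the projections have to be made Borel
    measurable before \<open>y \<le> t\<close> can be handled.\<close>
  have [measurable]: "fst \<in> borel_measurable (F \<Otimes>\<^sub>M unit_lborel)"
      "snd \<in> borel_measurable (F \<Otimes>\<^sub>M unit_lborel)"
    by (rule measurable_compose[OF measurable_fst, of "\<lambda>y. y"]
        measurable_compose[OF measurable_snd, of "\<lambda>y. y"], measurable)+
  have "integrable (F \<Otimes>\<^sub>M unit_lborel) (\<lambda>(y, t). if y \<le> t then f t else g t)"
  proof (rule P.integrable_const_bound[of _ B])
    show "AE x in F \<Otimes>\<^sub>M unit_lborel. norm (case x of (y, t) \<Rightarrow> if y \<le> t then f t else g t) \<le> B"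
      using B by (intro AE_I2) auto
    show "(\<lambda>(y, t). if y \<le> t then f t else g t) \<in> borel_measurable (F \<Otimes>\<^sub>M unit_lborel)"
      by (simp add: case_prod_beta)
  qed
  then show ?thesis
    by (subst P.Fubini_integral[symmetric]) (simp_all add: integral_threshold[OF F])
qed

text \<open>After the demand is integrated out, the integrand is again two-valued, now with
  threshold condition \<open>a \<le> t\<close>, so the same swap can average over a random
  action.\<close>

lemma cost_eq_integral:
  assumes F: "F \<in> Delta" and a: "a \<in> {0..1}"
  shows "cost c\<^sub>o c\<^sub>u a F =
    (LINT t|unit_lborel. (if a \<le> t then c\<^sub>u * (1 - cdfY F t) else c\<^sub>o * cdfY F t))"
proof -
  have "cost c\<^sub>o c\<^sub>u a F = (LINT y|F. LINT t|unit_lborel.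
      (if y \<le> t then c\<^sub>o * indicator {..<a} t else c\<^sub>u * indicator {a..} t))"
    unfolding cost_def using DeltaD(3)[OF F] a
    by (intro Bochner_Integration.integral_cong refl) (auto simp: loss_eq_integral)
  also have "\<dots> = (LINT t|unit_lborel.
      c\<^sub>o * indicator {..<a} t * cdfY F t + c\<^sub>u * indicator {a..} t * (1 - cdfY F t))"
    by (rule Fubini_threshold[OF F, of _ _ "\<bar>c\<^sub>o\<bar> + \<bar>c\<^sub>u\<bar>"]) (auto simp: indicator_def)
  also have "\<dots> = (LINT t|unit_lborel. (if a \<le> t then c\<^sub>u * (1 - cdfY F t) else c\<^sub>o * cdfY F t))"
    by (rule Bochner_Integration.integral_cong) (auto simp: indicator_def)
  finally show ?thesis .
qed

lemma mixed_cost_eq_integral: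
  assumes F: "F \<in> Delta" and G: "G \<in> Delta"
  shows "mixed_cost c\<^sub>o c\<^sub>u G F =
    (LINT t|unit_lborel. c\<^sub>u * (1 - cdfY F t) * cdfY G t + c\<^sub>o * cdfY F t * (1 - cdfY G t))"
proof -
  have "mixed_cost c\<^sub>o c\<^sub>u G F = (LINT a|G. LINT t|unit_lborel.
      (if a \<le> t then c\<^sub>u * (1 - cdfY F t) else c\<^sub>o * cdfY F t))"
    unfolding mixed_cost_def using DeltaD(3)[OF G]
    by (intro Bochner_Integration.integral_cong refl) (auto simp: cost_eq_integral[OF F])
  also have "\<dots> = (LINT t|unit_lborel.
      c\<^sub>u * (1 - cdfY F t) * cdfY G t + c\<^sub>o * cdfY F t * (1 - cdfY G t))"
  proof (rule Fubini_threshold[OF G, of _ _ "\<bar>c\<^sub>o\<bar> + \<bar>c\<^sub>u\<bar>"])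
    fix t
    have "\<bar>cdfY F t\<bar> \<le> 1" "\<bar>1 - cdfY F t\<bar> \<le> 1"
      using cdfY_bounds[OF F, of t] by auto
    then have "\<bar>c\<^sub>u\<bar> * \<bar>1 - cdfY F t\<bar> \<le> \<bar>c\<^sub>u\<bar>" "\<bar>c\<^sub>o\<bar> * \<bar>cdfY F t\<bar> \<le> \<bar>c\<^sub>o\<bar>"
      by (simp_all add: mult_left_le)
    then show "\<bar>c\<^sub>u * (1 - cdfY F t)\<bar> \<le> \<bar>c\<^sub>o\<bar> + \<bar>c\<^sub>u\<bar>" "\<bar>c\<^sub>o * cdfY F t\<bar> \<le> \<bar>c\<^sub>o\<bar> + \<bar>c\<^sub>u\<bar>"
      unfolding abs_mult using abs_ge_zero[of c\<^sub>o] abs_ge_zero[of c\<^sub>u] by linarith+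
  qed (use F in measurable)
  finally show ?thesis .
qed

section \<open>Cost and regret at a single threshold\<close>

text \<open>
  \<open>u\<close> and \<open>v\<close> stand for the values at one \<open>t\<close> of the demand cdf and the action cdf.
\<close>
definition pointwise_cost :: "real \<Rightarrow> real \<Rightarrow> real \<Rightarrow> real \<Rightarrow> real" where
  "pointwise_cost c\<^sub>o c\<^sub>u u v = c\<^sub>u * (1 - u) * v + c\<^sub>o * u * (1 - v)"

text \<open>\<open>pointwise_cost\<close> is affine in \<open>v\<close>, so its least value over
  \<open>v\<close> in \<open>[0,1]\<close> is attained at \<open>v = 1\<close> or
  \<open>v = 0\<close>; the subtracted minimum compares these two values.\<close>

definition pointwise_regret :: "real \<Rightarrow> real \<Rightarrow> real \<Rightarrow> real \<Rightarrow> real" where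
  "pointwise_regret c\<^sub>o c\<^sub>u u v = pointwise_cost c\<^sub>o c\<^sub>u u v - min (c\<^sub>u * (1 - u)) (c\<^sub>o * u)"

lemma pointwise_cost_bounds:
  assumes "0 \<le> u" "u \<le> 1" "0 \<le> v" "v \<le> 1"
  shows "\<bar>pointwise_cost c\<^sub>o c\<^sub>u u v\<bar> \<le> \<bar>c\<^sub>o\<bar> + \<bar>c\<^sub>u\<bar>"
proof -
  have "(1 - u) * v \<le> 1" "u * (1 - v) \<le> 1"
    using assms by (auto intro: mult_le_one)
  then have "\<bar>c\<^sub>u\<bar> * ((1 - u) * v) \<le> \<bar>c\<^sub>u\<bar>" "\<bar>c\<^sub>o\<bar> * (u * (1 - v)) \<le> \<bar>c\<^sub>o\<bar>"
    by (simp_all add: mult_left_le)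
  moreover have "\<bar>c\<^sub>u * (1 - u) * v\<bar> = \<bar>c\<^sub>u\<bar> * ((1 - u) * v)" "\<bar>c\<^sub>o * u * (1 - v)\<bar> = \<bar>c\<^sub>o\<bar> * (u * (1 - v))"
    using assms by (simp_all add: abs_mult)
  ultimately show ?thesis
    unfolding pointwise_cost_def by linarith
qed

section \<open>Expected regret through the law of the action\<close>

lemma (in prob_space) abs_integral_le_const:
  fixes f :: "'a \<Rightarrow> real"
  assumes f: "f \<in> borel_measurable M" and B: "\<And>x. x \<in> space M \<Longrightarrow> \<bar>f x\<bar> \<le> B"
  shows "\<bar>\<integral>x. f x \<partial>M\<bar> \<le> B"
proof -
  have b: "AE x in M. \<bar>f x\<bar> \<le> B"
    using B by (rule AE_I2)
  then have "integrable M f"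
    using f by (intro integrable_const_bound[of f B]) simp_all
  then have "(\<integral>x. \<bar>f x\<bar> \<partial>M) \<le> B"
    using b by (intro integral_le_const integrable_abs)
  then show ?thesis
    using integral_abs_bound[of M f] by linarith
qed

lemma loss_measurable:
  assumes "F \<in> Delta"
  shows "case_prod (loss c\<^sub>o c\<^sub>u) \<in> borel_measurable (borel \<Otimes>\<^sub>M F)"
proof -
  have [measurable]: "fst \<in> borel_measurable ((borel :: real measure) \<Otimes>\<^sub>M F)"
    by (rule measurable_fst)
  have [measurable]: "snd \<in> borel_measurable ((borel :: real measure) \<Otimes>\<^sub>M F)"
    using measurable_compose[OF measurable_snd borel_measurable_Delta[OF assms measurable_ident]]
    by simp
  show ?thesis
    unfolding loss_def case_prod_beta by measurable
qed

lemma cost_measurable: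
  assumes "F \<in> Delta"
  shows "(\<lambda>a. cost c\<^sub>o c\<^sub>u a F) \<in> borel_measurable Y_space"
proof -
  interpret prob_space F using DeltaD(1)[OF assms] .
  have "(\<lambda>a. cost c\<^sub>o c\<^sub>u a F) \<in> borel_measurable borel"
    unfolding cost_def
    by (rule borel_measurable_lebesgue_integral[OF loss_measurable[OF assms]])
  then show ?thesis
    unfolding Y_space_def by (rule measurable_restrict_space1)
qed

lemma abs_cost_le:
  assumes F: "F \<in> Delta" and a: "a \<in> {0..1}"
  shows "\<bar>cost c\<^sub>o c\<^sub>u a F\<bar> \<le> \<bar>c\<^sub>o\<bar> + \<bar>c\<^sub>u\<bar>"
  unfolding cost_def
proof (rule prob_space.abs_integral_le_const[OF DeltaD(1)[OF F]])
  show "loss c\<^sub>o c\<^sub>u a \<in> borel_measurable F"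
    unfolding loss_def[abs_def] by (rule borel_measurable_Delta[OF F]) measurable
  fix y assume "y \<in> space F"
  then have "\<bar>max 0 (a - y)\<bar> \<le> 1" "\<bar>max 0 (y - a)\<bar> \<le> 1"
    using a by (auto simp: DeltaD(3)[OF F])
  then have "\<bar>c\<^sub>o * max 0 (a - y)\<bar> \<le> \<bar>c\<^sub>o\<bar>" "\<bar>c\<^sub>u * max 0 (y - a)\<bar> \<le> \<bar>c\<^sub>u\<bar>"
    unfolding abs_mult by (simp_all only: mult_left_le abs_ge_zero)
  then show "\<bar>loss c\<^sub>o c\<^sub>u a y\<bar> \<le> \<bar>c\<^sub>o\<bar> + \<bar>c\<^sub>u\<bar>"
    unfolding loss_def by linarith
qed

text \<open>\<open>G\<close> is the unconditional law of the action. The cost is integrated linearly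
  against the policy, so averaging over samples replaces the random law by \<open>G\<close>, while
  the benchmark cost is constant in the samples.\<close>

lemma expected_regret_eq:
  assumes \<pi>: "\<pi> \<in> policies X n" and x: "x \<in> {0..n} \<rightarrow>\<^sub>E X"
    and F0: "F0 \<in> Delta" and F: "F \<in> {1..n} \<rightarrow>\<^sub>E Delta"
  defines "G \<equiv> (\<Pi>\<^sub>M i\<in>{1..n}. F i) \<bind> \<pi> x"
  shows "G \<in> Delta"
    and "expected_regret c\<^sub>o c\<^sub>u n \<pi> x F0 F =
      (LINT t|unit_lborel. pointwise_cost c\<^sub>o c\<^sub>u (cdfY F0 t) (cdfY G t))
        - cost c\<^sub>o c\<^sub>u (opt_action c\<^sub>o c\<^sub>u F0) F0"
proof -
  let ?M = "\<Pi>\<^sub>M i\<in>{1..n}. F i"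
  interpret M: prob_space ?M
    using F by (intro prob_space_PiM DeltaD(1)) auto
  have sets_M: "sets ?M = sets (\<Pi>\<^sub>M i\<in>{1..n}. Y_space)"
    using F by (intro sets_PiM_cong refl DeltaD(2)) auto
  have K: "\<pi> x \<in> (\<Pi>\<^sub>M i\<in>{1..n}. Y_space) \<rightarrow>\<^sub>M prob_algebra Y_space"
    using \<pi> x by (auto simp: policies_def)
  have K': "\<pi> x \<in> ?M \<rightarrow>\<^sub>M prob_algebra Y_space"
    unfolding measurable_cong_sets[OF sets_M refl] by (rule K)
  have M: "?M \<in> space (prob_algebra (\<Pi>\<^sub>M i\<in>{1..n}. Y_space))"
    using sets_M M.prob_space_axioms by (simp add: space_prob_algebra)
  show G: "G \<in> Delta"
    unfolding G_def Delta_def space_prob_algebra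
    using prob_space_bind'[OF M K] sets_bind'[OF M K] by simp
  have kernel: "\<pi> x y \<in> Delta" if "y \<in> space ?M" for y
    using measurable_space[OF K' that] by (simp add: Delta_def)
  let ?c = "\<lambda>a. cost c\<^sub>o c\<^sub>u a F0"
  note c_meas = cost_measurable[OF F0, of c\<^sub>o c\<^sub>u] and cost_bound = abs_cost_le[OF F0, of _ c\<^sub>o c\<^sub>u]
  \<comment> \<open>Integrating a fixed measurable function is a measurable functional on the Giry
    space; it is composed with the kernel.\<close>
  have mixed_meas: "(\<lambda>y. mixed_cost c\<^sub>o c\<^sub>u (\<pi> x y) F0) \<in> borel_measurable ?M"
    unfolding mixed_cost_def
    by (rule measurable_compose[OF measurable_prob_algebraD[OF K']
          integral_measurable_subprob_algebra[OF c_meas]])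
  have mixed_bound: "\<bar>mixed_cost c\<^sub>o c\<^sub>u (\<pi> x y) F0\<bar> \<le> \<bar>c\<^sub>o\<bar> + \<bar>c\<^sub>u\<bar>" if "y \<in> space ?M" for y
  proof -
    note \<nu> = kernel[OF that]
    have m: "?c \<in> borel_measurable (\<pi> x y)"
      unfolding measurable_cong_sets[OF DeltaD(2)[OF \<nu>] refl] by (rule c_meas)
    show ?thesis
      unfolding mixed_cost_def
    proof (rule prob_space.abs_integral_le_const[OF DeltaD(1)[OF \<nu>] m])
      show "\<bar>?c a\<bar> \<le> \<bar>c\<^sub>o\<bar> + \<bar>c\<^sub>u\<bar>" if "a \<in> space (\<pi> x y)" for a
        using that by (intro cost_bound) (simp add: DeltaD(3)[OF \<nu>])
    qed
  qed
  have int: "integrable ?M (\<lambda>y. mixed_cost c\<^sub>o c\<^sub>u (\<pi> x y) F0)"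
    using mixed_bound by (intro M.integrable_const_bound[OF _ mixed_meas] AE_I2) auto
  have "expected_regret c\<^sub>o c\<^sub>u n \<pi> x F0 F =
      (LINT y|?M. mixed_cost c\<^sub>o c\<^sub>u (\<pi> x y) F0) - ?c (opt_action c\<^sub>o c\<^sub>u F0)"
    unfolding expected_regret_def regret_def
    by (simp only: Bochner_Integration.integral_diff[OF int M.integrable_const]
        lebesgue_integral_const M.prob_space scaleR_one)
  also have "(LINT y|?M. mixed_cost c\<^sub>o c\<^sub>u (\<pi> x y) F0) = mixed_cost c\<^sub>o c\<^sub>u G F0"
    unfolding mixed_cost_def G_def
  proof (rule integral_bind[OF c_meas _ measurable_prob_algebraD[OF K'], symmetric])
    show "\<bar>?c a\<bar> \<le> \<bar>c\<^sub>o\<bar> + \<bar>c\<^sub>u\<bar>" if "a \<in> space Y_space" for a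
      using that by (intro cost_bound) (simp add: Y_space_def space_restrict_space)
    show "AE y in ?M. emeasure (\<pi> x y) (space (\<pi> x y)) \<le> ennreal 1"
      using kernel by (intro AE_I2) (simp add: prob_space.emeasure_space_1[OF DeltaD(1)])
    show "finite_measure ?M"
      by (rule M.finite_measure_axioms)
  qed
  also have "mixed_cost c\<^sub>o c\<^sub>u G F0 =
      (LINT t|unit_lborel. pointwise_cost c\<^sub>o c\<^sub>u (cdfY F0 t) (cdfY G t))"
    unfolding mixed_cost_eq_integral[OF F0 G] pointwise_cost_def ..
  finally show "expected_regret c\<^sub>o c\<^sub>u n \<pi> x F0 F =
      (LINT t|unit_lborel. pointwise_cost c\<^sub>o c\<^sub>u (cdfY F0 t) (cdfY G t))
        - cost c\<^sub>o c\<^sub>u (opt_action c\<^sub>o c\<^sub>u F0) F0" .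
qed


section \<open>The cost of the optimal action\<close>

text \<open>By \<open>cost_eq_integral\<close>, an action picks one of the two arguments of the
  minimum at each \<open>t\<close>.\<close>

lemma integral_min_le_cost:
  assumes F: "F \<in> Delta" and a: "a \<in> {0..1}"
  shows "(LINT t|unit_lborel. min (c\<^sub>u * (1 - cdfY F t)) (c\<^sub>o * cdfY F t)) \<le> cost c\<^sub>o c\<^sub>u a F"
proof -
  have [measurable]: "cdfY F \<in> borel_measurable borel" using F by measurable
  have bound: "\<bar>c\<^sub>u * (1 - cdfY F t)\<bar> \<le> \<bar>c\<^sub>o\<bar> + \<bar>c\<^sub>u\<bar>" "\<bar>c\<^sub>o * cdfY F t\<bar> \<le> \<bar>c\<^sub>o\<bar> + \<bar>c\<^sub>u\<bar>" for t
    \<comment> \<open>The values \<open>v = 1\<close> and \<open>v = 0\<close> isolate the two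
      terms.\<close>
    using pointwise_cost_bounds[of "cdfY F t" 1 c\<^sub>o c\<^sub>u] pointwise_cost_bounds[of "cdfY F t" 0 c\<^sub>o c\<^sub>u]
      cdfY_bounds[OF F, of t] by (simp_all add: pointwise_cost_def)
  show ?thesis
    unfolding cost_eq_integral[OF F a]
  proof (rule integral_mono)
    show "integrable unit_lborel (\<lambda>t. min (c\<^sub>u * (1 - cdfY F t)) (c\<^sub>o * cdfY F t))"
      using bound by (intro unit_lborel_integrable[of _ "\<bar>c\<^sub>o\<bar> + \<bar>c\<^sub>u\<bar>"]) (auto simp: min_def)
    show "integrable unit_lborel (\<lambda>t. if a \<le> t then c\<^sub>u * (1 - cdfY F t) else c\<^sub>o * cdfY F t)"
      using bound by (intro unit_lborel_integrable[of _ "\<bar>c\<^sub>o\<bar> + \<bar>c\<^sub>u\<bar>"]) auto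
  qed auto
qed

text \<open>The infimum is over a nonempty set: it contains 1, where the cdf is 1 and the critical
  ratio is at most 1. Membership makes \<open>integral_min_le_cost\<close> applicable to the optimal
  action.\<close>

lemma opt_action_in:
  assumes F: "F \<in> Delta" and "0 < c\<^sub>o" "0 < c\<^sub>u"
  shows "opt_action c\<^sub>o c\<^sub>u F \<in> {0..1}"
proof -
  let ?S = "{a \<in> {0..1}. cdfY F a \<ge> c\<^sub>u / (c\<^sub>u + c\<^sub>o)}"
  have "1 \<in> ?S"
    using assms by (simp add: cdfY_1)
  moreover have "bdd_below ?S"
    by (rule bdd_belowI[of _ 0]) auto
  ultimately show ?thesis
    unfolding opt_action_def
    by (auto intro!: cInf_greatest intro: cInf_lower)
qed

section \<open>Bernoulli demand\<close>

lemma of_bool_measurable_Y_space: "of_bool \<in> measure_pmf p \<rightarrow>\<^sub>M Y_space"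
  by (auto simp: Y_space_def space_restrict_space)

lemma bern_in_Delta: "bern \<mu> \<in> Delta"
  unfolding bern_def Delta_def space_prob_algebra
  by (auto intro: measure_pmf.prob_space_distr of_bool_measurable_Y_space)

lemma cdfY_bern:
  assumes "\<mu> \<in> {0..1}" "0 \<le> t" "t < 1"
  shows "cdfY (bern \<mu>) t = 1 - \<mu>"
proof -
  have "cdfY (bern \<mu>) t = measure (bernoulli_pmf \<mu>) {False}"
    unfolding cdfY_def bern_def
    using assms sets_Delta_le[OF bern_in_Delta, of \<mu> t]
    by (subst measure_distr[OF of_bool_measurable_Y_space])
       (auto simp: bern_def Y_space_def space_restrict_space intro!: arg_cong[of _ _ "measure _"] split: if_splits)
  then show ?thesis
    using assms by (simp add: measure_pmf_single)
qed

lemma cost_bern: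
  assumes "\<mu> \<in> {0..1}"
  shows "cost c\<^sub>o c\<^sub>u a (bern \<mu>) = loss c\<^sub>o c\<^sub>u a 1 * \<mu> + loss c\<^sub>o c\<^sub>u a 0 * (1 - \<mu>)"
proof -
  have "loss c\<^sub>o c\<^sub>u a \<in> borel_measurable Y_space"
    unfolding Y_space_def loss_def[abs_def] by (rule measurable_restrict_space1) measurable
  then show ?thesis
    using assms unfolding cost_def bern_def
    by (subst integral_distr[OF of_bool_measurable_Y_space]) auto
qed

text \<open>The Bernoulli quantile is 0 or 1, with cost \<open>c\<^sub>u * \<mu>\<close> or
  \<open>c\<^sub>o * (1 - \<mu>)\<close>, and comparing \<open>1 - \<mu>\<close> with the critical
  ratio selects the cheaper of the two.\<close>

lemma cost_opt_action_bern:
  assumes \<mu>: "\<mu> \<in> {0..1}" and c: "0 < c\<^sub>o" "0 < c\<^sub>u" "c\<^sub>o + c\<^sub>u = 1"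
  shows "cost c\<^sub>o c\<^sub>u (opt_action c\<^sub>o c\<^sub>u (bern \<mu>)) (bern \<mu>) \<le> min (c\<^sub>u * \<mu>) (c\<^sub>o * (1 - \<mu>))"
proof -
  let ?S = "{a \<in> {0..1}. cdfY (bern \<mu>) a \<ge> c\<^sub>u / (c\<^sub>u + c\<^sub>o)}"
  have q: "c\<^sub>u / (c\<^sub>u + c\<^sub>o) = c\<^sub>u" using c by (simp add: add.commute)
  \<comment> \<open>Since the costs sum to 1, the difference of the two sides is
    \<open>1 - \<mu> - c\<^sub>u\<close>.\<close>
  have *: "c\<^sub>u * \<mu> \<le> c\<^sub>o * (1 - \<mu>) \<longleftrightarrow> c\<^sub>u \<le> 1 - \<mu>"
  proof -
    have "c\<^sub>o * (1 - \<mu>) - c\<^sub>u * \<mu> = (c\<^sub>o + c\<^sub>u) * (1 - \<mu>) - c\<^sub>u"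
      by (simp add: algebra_simps)
    then show ?thesis using c by auto
  qed
  show ?thesis
  proof (cases "c\<^sub>u \<le> 1 - \<mu>")
    case True
    then have "0 \<in> ?S"
      using \<mu> by (simp add: q cdfY_bern)
    then have "opt_action c\<^sub>o c\<^sub>u (bern \<mu>) = 0"
      unfolding opt_action_def by (intro cInf_eq_minimum) auto
    then show ?thesis
      using * True by (simp add: cost_bern[OF \<mu>] loss_def)
  next
    case False
    \<comment> \<open>Below 1 the cdf stays at \<open>1 - \<mu>\<close>, which is less than the
      critical ratio here.\<close>
    have "1 \<le> a" if "a \<in> ?S" for a
      using that False \<mu> by (cases "a < 1") (auto simp: q cdfY_bern)
    moreover have "opt_action c\<^sub>o c\<^sub>u (bern \<mu>) \<in> {0..1}"
      by (rule opt_action_in[OF bern_in_Delta c(1,2)])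
    moreover have "1 \<in> ?S"
      using c by (simp add: q cdfY_1[OF bern_in_Delta])
    then have "?S \<noteq> {}"
      by blast
    ultimately have "opt_action c\<^sub>o c\<^sub>u (bern \<mu>) = 1"
      unfolding opt_action_def by (auto intro!: antisym cInf_greatest)
    then show ?thesis
      using * False by (simp add: cost_bern[OF \<mu>] loss_def)
  qed
qed

section \<open>Comparison with Bernoulli instances\<close>

text \<open>The benchmark enters with a minus sign, so the lower bound
  \<open>integral_min_le_cost\<close> suffices; optimality of the quantile is never invoked.\<close>

lemma expected_regret_le:
  assumes \<pi>: "\<pi> \<in> policies X n" and x: "x \<in> {0..n} \<rightarrow>\<^sub>E X"
    and F0: "F0 \<in> Delta" and F: "F \<in> {1..n} \<rightarrow>\<^sub>E Delta" and c: "0 < c\<^sub>o" "0 < c\<^sub>u"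
  defines "G \<equiv> (\<Pi>\<^sub>M i\<in>{1..n}. F i) \<bind> \<pi> x"
  shows "integrable unit_lborel (\<lambda>t. pointwise_regret c\<^sub>o c\<^sub>u (cdfY F0 t) (cdfY G t))" (is ?int)
    and "expected_regret c\<^sub>o c\<^sub>u n \<pi> x F0 F \<le>
      (LINT t|unit_lborel. pointwise_regret c\<^sub>o c\<^sub>u (cdfY F0 t) (cdfY G t))" (is ?le)
proof -
  have G: "G \<in> Delta"
    unfolding G_def by (rule expected_regret_eq(1)[OF \<pi> x F0 F])
  note [measurable] = borel_measurable_cdfY[OF F0] borel_measurable_cdfY[OF G]
  let ?B = "\<bar>c\<^sub>o\<bar> + \<bar>c\<^sub>u\<bar>"
  have i1: "integrable unit_lborel (\<lambda>t. pointwise_cost c\<^sub>o c\<^sub>u (cdfY F0 t) (cdfY G t))"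
  proof (rule unit_lborel_integrable)
    show "(\<lambda>t. pointwise_cost c\<^sub>o c\<^sub>u (cdfY F0 t) (cdfY G t)) \<in> borel_measurable borel"
      unfolding pointwise_cost_def by measurable
    show "\<bar>pointwise_cost c\<^sub>o c\<^sub>u (cdfY F0 t) (cdfY G t)\<bar> \<le> ?B" for t
      by (intro pointwise_cost_bounds cdfY_bounds F0 G)
  qed
  have i2: "integrable unit_lborel (\<lambda>t. min (c\<^sub>u * (1 - cdfY F0 t)) (c\<^sub>o * cdfY F0 t))"
  proof (rule unit_lborel_integrable)
    show "\<bar>min (c\<^sub>u * (1 - cdfY F0 t)) (c\<^sub>o * cdfY F0 t)\<bar> \<le> ?B" for t
      using pointwise_cost_bounds[of "cdfY F0 t" 1 c\<^sub>o c\<^sub>u] pointwise_cost_bounds[of "cdfY F0 t" 0 c\<^sub>o c\<^sub>u]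
        cdfY_bounds[OF F0, of t] by (simp add: pointwise_cost_def min_def)
  qed measurable
  show ?int
    unfolding pointwise_regret_def using i1 i2 by simp
  show ?le
    unfolding pointwise_regret_def
    using expected_regret_eq(2)[OF \<pi> x F0 F, of c\<^sub>o c\<^sub>u, folded G_def]
      integral_min_le_cost[OF F0 opt_action_in[OF F0 c]] i1 i2
    by simp
qed

text \<open>Bernoulli cdfs are constant on \<open>[0,1)\<close>, and by separability so is the cdf
  of the action. The cost integral thus collapses to one value of \<open>pointwise_cost\<close>, and
  \<open>cost_opt_action_bern\<close> bounds the benchmark from above.\<close>

lemma expected_regret_bern_ge:
  assumes \<pi>: "\<pi> \<in> policies X n" and x: "x \<in> {0..n} \<rightarrow>\<^sub>E X"
    and \<mu>: "\<And>i. i \<in> {0..n} \<Longrightarrow> \<mu> i \<in> {0..1}" and c: "0 < c\<^sub>o" "0 < c\<^sub>u" "c\<^sub>o + c\<^sub>u = 1"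
    and P: "\<And>F y. F \<in> {1..n} \<rightarrow>\<^sub>E Delta \<Longrightarrow>
      cdfY ((\<Pi>\<^sub>M i\<in>{1..n}. F i) \<bind> \<pi> x) y = P (\<lambda>i\<in>{1..n}. cdfY (F i) y)"
  shows "pointwise_regret c\<^sub>o c\<^sub>u (1 - \<mu> 0) (P (\<lambda>i\<in>{1..n}. 1 - \<mu> i)) \<le>
    expected_regret c\<^sub>o c\<^sub>u n \<pi> x (bern (\<mu> 0)) (\<lambda>i\<in>{1..n}. bern (\<mu> i))"
proof -
  let ?F = "\<lambda>i\<in>{1..n}. bern (\<mu> i)"
  let ?G = "(\<Pi>\<^sub>M i\<in>{1..n}. ?F i) \<bind> \<pi> x"
  let ?p = "P (\<lambda>i\<in>{1..n}. 1 - \<mu> i)"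
  have F: "?F \<in> {1..n} \<rightarrow>\<^sub>E Delta"
    by (auto simp: bern_in_Delta)
  have G: "?G \<in> Delta"
    by (rule expected_regret_eq(1)[OF \<pi> x bern_in_Delta F])
  have cdf_G: "cdfY ?G t = ?p" if "0 \<le> t" "t < 1" for t
  proof -
    have "(\<lambda>i\<in>{1..n}. cdfY (?F i) t) = (\<lambda>i\<in>{1..n}. 1 - \<mu> i)"
      using \<mu> that by (intro restrict_ext) (auto simp: cdfY_bern)
    then show ?thesis using P[OF F] by metis
  qed
  have "(LINT t|unit_lborel. pointwise_cost c\<^sub>o c\<^sub>u (cdfY (bern (\<mu> 0)) t) (cdfY ?G t)) =
        (LINT t|unit_lborel. pointwise_cost c\<^sub>o c\<^sub>u (1 - \<mu> 0) ?p)"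
  proof (rule integral_cong_AE)
    note [measurable] = borel_measurable_cdfY[OF bern_in_Delta] borel_measurable_cdfY[OF G]
    show "(\<lambda>t. pointwise_cost c\<^sub>o c\<^sub>u (cdfY (bern (\<mu> 0)) t) (cdfY ?G t)) \<in> borel_measurable unit_lborel"
      unfolding pointwise_cost_def by (rule measurable_unit_lborel) measurable
    show "AE t in unit_lborel. pointwise_cost c\<^sub>o c\<^sub>u (cdfY (bern (\<mu> 0)) t) (cdfY ?G t) =
        pointwise_cost c\<^sub>o c\<^sub>u (1 - \<mu> 0) ?p"
      using AE_unit_lborel_less_1 AE_space
    proof eventually_elim
      case (elim t)
      then have t: "0 \<le> t" "t < 1"
        by simp_all
      show ?case
        by (simp only: cdf_G[OF t] cdfY_bern[OF \<mu>[of 0] t] atLeastAtMost_iff order.refl zero_le)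
    qed
  qed simp
  moreover have "(LINT t|unit_lborel. pointwise_cost c\<^sub>o c\<^sub>u (1 - \<mu> 0) ?p) = pointwise_cost c\<^sub>o c\<^sub>u (1 - \<mu> 0) ?p"
    by simp
  moreover have "cost c\<^sub>o c\<^sub>u (opt_action c\<^sub>o c\<^sub>u (bern (\<mu> 0))) (bern (\<mu> 0)) \<le>
      min (c\<^sub>u * (1 - (1 - \<mu> 0))) (c\<^sub>o * (1 - \<mu> 0))"
    using cost_opt_action_bern[OF \<mu>[of 0] c] by simp
  ultimately show ?thesis
    using expected_regret_eq(2)[OF \<pi> x bern_in_Delta F, of c\<^sub>o c\<^sub>u "\<mu> 0"]
    unfolding pointwise_regret_def by linarith
qed

text \<open>Weak duality for one choice of distributions and one multiplier vector;
  \<open>\<delta> i\<close> stands for the radius \<open>d (x 0) (x i)\<close>.\<close>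

lemma expected_regret_le_SUP_bern:
  assumes c: "0 < c\<^sub>o" "0 < c\<^sub>u" "c\<^sub>o + c\<^sub>u = 1"
    and x: "x \<in> {0..n} \<rightarrow>\<^sub>E X" and \<pi>: "\<pi> \<in> policies X n" and sep: "separable n \<pi> x"
    and F0: "F0 \<in> Delta" and F: "F \<in> {1..n} \<rightarrow>\<^sub>E Delta"
    and W: "\<And>i. i \<in> {1..n} \<Longrightarrow> wasserstein F0 (F i) \<le> \<delta> i"
    and l: "\<And>i. i \<in> {1..n} \<Longrightarrow> 0 \<le> l i"
  shows "ereal (expected_regret c\<^sub>o c\<^sub>u n \<pi> x F0 F) \<le>
    (SUP \<mu> \<in> {0..n} \<rightarrow>\<^sub>E {0..1::real}.
      ereal (expected_regret c\<^sub>o c\<^sub>u n \<pi> x (bern (\<mu> 0)) (\<lambda>i\<in>{1..n}. bern (\<mu> i))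
        + (\<Sum>i=1..n. l i * (\<delta> i - \<bar>\<mu> 0 - \<mu> i\<bar>))))" (is "_ \<le> (SUP \<mu> \<in> ?M. ereal (?\<Phi> \<mu>))")
proof -
  obtain P where P: "\<And>F y. F \<in> {1..n} \<rightarrow>\<^sub>E Delta \<Longrightarrow>
      cdfY ((\<Pi>\<^sub>M i\<in>{1..n}. F i) \<bind> \<pi> x) y = P (\<lambda>i\<in>{1..n}. cdfY (F i) y)"
    using sep unfolding separable_def cdfY_def by blast
  define G where "G = (\<Pi>\<^sub>M i\<in>{1..n}. F i) \<bind> \<pi> x"
  \<comment> \<open>The Lagrangian integrand: regret and penalty at the same threshold.\<close>
  define g where "g t = pointwise_regret c\<^sub>o c\<^sub>u (cdfY F0 t) (cdfY G t)
      + (\<Sum>i=1..n. l i * (\<delta> i - \<bar>cdfY F0 t - cdfY (F i) t\<bar>))" for t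
  have Fi: "F i \<in> Delta" if "i \<in> {1..n}" for i
    using F that by auto
  have int_abs: "integrable unit_lborel (\<lambda>t. \<bar>cdfY F0 t - cdfY (F i) t\<bar>)" if "i \<in> {1..n}" for i
  proof (rule unit_lborel_integrable)
    show "(\<lambda>t. \<bar>cdfY F0 t - cdfY (F i) t\<bar>) \<in> borel_measurable borel"
      using borel_measurable_cdfY[OF F0] borel_measurable_cdfY[OF Fi[OF that]] by measurable
    show "\<bar>\<bar>cdfY F0 t - cdfY (F i) t\<bar>\<bar> \<le> 1" for t
      using cdfY_bounds[OF F0, of t] cdfY_bounds[OF Fi[OF that], of t] by auto
  qed
  note regret = expected_regret_le[OF \<pi> x F0 F c(1,2), folded G_def]
  have int_term: "integrable unit_lborel (\<lambda>t. l i * (\<delta> i - \<bar>cdfY F0 t - cdfY (F i) t\<bar>))"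
    if "i \<in> {1..n}" for i
    using int_abs[OF that] by (intro integrable_mult_right Bochner_Integration.integrable_diff) auto
  have int_g: "integrable unit_lborel g"
    unfolding g_def
    using regret(1) int_term
    by (intro Bochner_Integration.integrable_add Bochner_Integration.integrable_sum) auto
  have "(LINT t|unit_lborel. (\<Sum>i=1..n. l i * (\<delta> i - \<bar>cdfY F0 t - cdfY (F i) t\<bar>))) =
      (\<Sum>i=1..n. l i * (\<delta> i - wasserstein F0 (F i)))"
    using int_term int_abs
    by (subst Bochner_Integration.integral_sum)
       (auto intro!: sum.cong simp: wasserstein_def integral_unit_lborel)
  \<comment> \<open>The Wasserstein constraints make the integrated penalty nonnegative, so adding
    it can only raise the bound.\<close>
  also have "\<dots> \<ge> 0"
    using W l by (intro sum_nonneg mult_nonneg_nonneg) auto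
  finally have "(LINT t|unit_lborel. pointwise_regret c\<^sub>o c\<^sub>u (cdfY F0 t) (cdfY G t)) \<le> (LINT t|unit_lborel. g t)"
    unfolding g_def using regret(1) int_term by (subst Bochner_Integration.integral_add) auto
  with regret(2) have le_g: "expected_regret c\<^sub>o c\<^sub>u n \<pi> x F0 F \<le> (LINT t|unit_lborel. g t)"
    by simp
  have g_le: "ereal (g t) \<le> (SUP \<mu> \<in> ?M. ereal (?\<Phi> \<mu>))" for t
  proof -
    \<comment> \<open>The Bernoulli law of mean \<open>1 - cdfY (F i) t\<close> has on all of
      \<open>[0,1)\<close> the cdf value that \<open>F i\<close> has at \<open>t\<close>; the
      complement leaves absolute differences unchanged.\<close>
    define \<mu> where "\<mu> = (\<lambda>i\<in>{0..n}. 1 - cdfY (if i = 0 then F0 else F i) t)"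
    have \<mu>: "\<mu> \<in> ?M"
      using cdfY_bounds[OF F0] cdfY_bounds[OF Fi] by (auto simp: \<mu>_def)
    have \<mu>_i: "\<mu> i = 1 - cdfY (F i) t" if "i \<in> {1..n}" for i
      using that by (auto simp: \<mu>_def)
    have \<mu>0: "\<mu> 0 = 1 - cdfY F0 t"
      by (simp add: \<mu>_def)
    have "cdfY G t = P (\<lambda>i\<in>{1..n}. 1 - \<mu> i)"
      unfolding G_def P[OF F] by (rule arg_cong[of _ _ P], rule restrict_ext) (simp add: \<mu>_i)
    moreover have "pointwise_regret c\<^sub>o c\<^sub>u (1 - \<mu> 0) (P (\<lambda>i\<in>{1..n}. 1 - \<mu> i)) \<le>
        expected_regret c\<^sub>o c\<^sub>u n \<pi> x (bern (\<mu> 0)) (\<lambda>i\<in>{1..n}. bern (\<mu> i))"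
      using \<mu> by (intro expected_regret_bern_ge[OF \<pi> x _ c P]) blast+
    moreover have "1 - \<mu> 0 = cdfY F0 t"
      by (simp add: \<mu>0)
    moreover have "(\<Sum>i=1..n. l i * (\<delta> i - \<bar>cdfY F0 t - cdfY (F i) t\<bar>)) =
        (\<Sum>i=1..n. l i * (\<delta> i - \<bar>\<mu> 0 - \<mu> i\<bar>))"
      by (intro sum.cong refl) (simp add: \<mu>0 \<mu>_i abs_minus_commute)
    ultimately have "g t \<le> ?\<Phi> \<mu>"
      by (simp only: g_def add_right_mono)
    also have "ereal (?\<Phi> \<mu>) \<le> (SUP \<mu> \<in> ?M. ereal (?\<Phi> \<mu>))"
      using \<mu> by (rule SUP_upper)
    finally show ?thesis by simp
  qed
  show ?thesis
  \<comment> \<open>A finite supremum bounds \<open>g\<close> pointwise, hence also its mean. An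
    infinite one is trivial, and minus infinity is excluded by \<open>g_le\<close> at 0.\<close>
  proof (cases "SUP \<mu> \<in> ?M. ereal (?\<Phi> \<mu>)")
    case (real r)
    then have "(LINT t|unit_lborel. g t) \<le> r"
      using g_le by (intro unit_lborel.integral_le_const int_g AE_I2) auto
    then show ?thesis using le_g real by simp
  qed (use g_le[of 0] in auto)
qed

theorem mainTheorem7:
  fixes X :: "'x set" and d :: "'x \<Rightarrow> 'x \<Rightarrow> real" and c\<^sub>o c\<^sub>u :: real and n :: nat
    and x :: "nat \<Rightarrow> 'x" and \<pi> :: "(nat \<Rightarrow> 'x) \<Rightarrow> (nat \<Rightarrow> real) \<Rightarrow> real measure"
  assumes d_nonneg: "\<And>u v. u \<in> X \<Longrightarrow> v \<in> X \<Longrightarrow> 0 \<le> d u v"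
    and "c\<^sub>o > 0" and "c\<^sub>u > 0" and "c\<^sub>o + c\<^sub>u = 1"
    and "n \<ge> 1"
    and "x \<in> {0..n} \<rightarrow>\<^sub>E X"
    and "\<pi> \<in> policies X n"
    and "separable n \<pi> x"
  shows
    "(SUP F0 \<in> Delta.
        SUP F \<in> {F \<in> {1..n} \<rightarrow>\<^sub>E Delta. \<forall>i\<in>{1..n}. wasserstein F0 (F i) \<le> d (x 0) (x i)}.
          ereal (expected_regret c\<^sub>o c\<^sub>u n \<pi> x F0 F))
     \<le> (INF l \<in> {1..n} \<rightarrow>\<^sub>E {0::real..}.
          SUP \<mu> \<in> {0..n} \<rightarrow>\<^sub>E {0..1::real}.
            ereal (expected_regret c\<^sub>o c\<^sub>u n \<pi> x (bern (\<mu> 0)) (\<lambda>i\<in>{1..n}. bern (\<mu> i))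
                   + (\<Sum>i=1..n. l i * (d (x 0) (x i) - \<bar>\<mu> 0 - \<mu> i\<bar>))))"
  using assms
  \<comment> \<open>Each admissible instance is compared with each multiplier vector separately, so
    no minimax exchange occurs.\<close>
  by (intro SUP_least INF_greatest expected_regret_le_SUP_bern) auto

end
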